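(* For every integer $r \geq 20$, $p_{r+1}^{\,r-\pi(r)} > 2^{p_{r+1}}$, and for every integer $r$ with $1 \leq r < 20$, $p_{r+1}^{\,r-\pi(r)} < 2^{p_{r+1}}$.
   Context: $p_n$ denotes the $n$th prime (so $p_1 = 2$, $p_2 = 3$, $p_3 = 5$, ...). $\pi(x)$ denotes the prime-counting function, i.e. the number of primes $\leq x$. *)

theory Defs
  imports
    Complex_Main
    "HOL-Library.Infinite_Set"
    "HOL-Computational_Algebra.Primes"
begin

(* enumerate counts from 0, while the first prime is p_1 = 2; the value at n = 0 is junk. *)
definition nth_prime :: "nat \<Rightarrow> nat" where
  "nth_prime n = enumerate {p. prime p} (n - 1)"

definition prime_pi :: "real \<Rightarrow> nat" where
  "prime_pi x = card {p::nat. prime p \<and> real p \<le> x}"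

end

theory Submission
  imports Defs "HOL-Number_Theory.Prime_Powers" "HOL-Number_Theory.Pocklington"
begin

text \<open>With \<open>P = p\<^bsub>r+1\<^esub>\<close>, so \<open>\<pi>(P) = r + 1\<close>, the question is whether
  \<open>(r - \<pi>(r)) ln P > P ln 2\<close>. Chebyshev's combination of factorials,
  \<open>n! (n/30)! / ((n/2)! (n/3)! (n/5)!)\<close>, yields \<open>(\<pi>(P) + 4) ln P \<ge> (35/27) P ln 2 + 5\<close>. Sieving by
  2, 3, 5 and 7 gives \<open>\<pi>(r) \<le> (8r - 135)/35\<close> for \<open>r \<ge> 284\<close>, that is,
  \<open>r - \<pi>(r) \<ge> (27/35)(r + 5)\<close>. The product of the two bounds is the inequality for \<open>r \<ge> 284\<close>.
  The primes below 1867 cover the remaining \<open>r\<close> by computation; since \<open>r - \<pi>(r)\<close> is monotone, one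
  estimate settles a whole interval of primes.\<close>

subsection \<open>The prime counting function\<close>

definition primes_upto :: "nat \<Rightarrow> nat" where
  "primes_upto n = card {p. prime p \<and> p \<le> n}"

lemma primes_upto_mono: "m \<le> n \<Longrightarrow> primes_upto m \<le> primes_upto n"
  unfolding primes_upto_def by (intro card_mono) auto

lemma primes_upto_less:
  assumes "m < n" "prime n"
  shows "primes_upto m < primes_upto n"
proof -
  have "n \<in> {p. prime p \<and> p \<le> n}" "n \<notin> {p. prime p \<and> p \<le> m}" using assms by auto
  moreover have "{p. prime p \<and> p \<le> m} \<subseteq> {p. prime p \<and> p \<le> n}" using assms by auto
  ultimately have "{p. prime p \<and> p \<le> m} \<subset> {p. prime p \<and> p \<le> n}" by blast
  then show ?thesis unfolding primes_upto_def by (intro psubset_card_mono) auto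
qed

text \<open>Each step of the argument adds at most one prime. Equivalently n - pi(n) is monotone,
  which lets one estimate serve a whole interval of primes.\<close>

lemma primes_upto_diff_le:
  assumes "m \<le> n"
  shows "primes_upto n \<le> primes_upto m + (n - m)"
proof -
  have "{p. prime p \<and> p \<le> n} \<subseteq> {p. prime p \<and> p \<le> m} \<union> {m<..n}" by auto
  then have "primes_upto n \<le> card ({p. prime p \<and> p \<le> m} \<union> {m<..n})"
    unfolding primes_upto_def by (intro card_mono) auto
  also have "\<dots> \<le> primes_upto m + card {m<..n}"
    unfolding primes_upto_def by (rule card_Un_le)
  finally show ?thesis by simp
qed

lemma primes_upto_le: "primes_upto n \<le> n"
proof -
  have "{p. prime p \<and> p \<le> n} \<subseteq> {0<..n}" by (auto simp: prime_gt_0_nat)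
  then have "primes_upto n \<le> card {0<..n}" unfolding primes_upto_def by (intro card_mono) auto
  then show ?thesis by simp
qed

lemma prime_nth_prime: "prime (nth_prime n)"
  unfolding nth_prime_def using enumerate_in_set[OF primes_infinite] by auto

lemma primes_upto_nth_prime: "primes_upto (nth_prime (Suc r)) = Suc r"
proof -
  let ?S = "{p::nat. prime p}"
  have inf: "infinite ?S" by (rule primes_infinite)
  \<comment> \<open>\<open>nth_prime (Suc r)\<close> is the entry with index \<open>r\<close> of the
    increasing enumeration from 0, so the primes up to it carry the r + 1 indices 0 to r.\<close>
  have "{p. prime p \<and> p \<le> nth_prime (Suc r)} = enumerate ?S ` {..r}"
  proof (intro equalityI subsetI)
    fix p assume p: "p \<in> {p. prime p \<and> p \<le> nth_prime (Suc r)}"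
    then obtain k where "p = enumerate ?S k" using enumerate_Ex[OF inf, of p] by auto
    with p inf show "p \<in> enumerate ?S ` {..r}" by (auto simp: nth_prime_def)
  next
    fix p assume "p \<in> enumerate ?S ` {..r}"
    then show "p \<in> {p. prime p \<and> p \<le> nth_prime (Suc r)}"
      using inf enumerate_in_set[OF inf] by (auto simp: nth_prime_def)
  qed
  moreover have "inj_on (enumerate ?S) {..r}"
    using inj_enumerate[OF inf] inj_on_subset by blast
  ultimately show ?thesis by (simp add: primes_upto_def card_image)
qed

subsection \<open>Chebyshev's lower bound\<close>

definition chebyshev_psi :: "nat \<Rightarrow> real" where
  "chebyshev_psi n = (\<Sum>d=1..n. mangoldt d)"

text \<open>Legendre's formula in logarithmic form: write ln k as the sum of
  \<open>mangoldt d\<close> over d dividing k and exchange the sums. Terms with d > n vanish, so a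
  common \<open>N\<close> can serve factorials of different arguments.\<close>

lemma ln_fact_conv_mangoldt:
  assumes "n \<le> N"
  shows "ln (fact n) = (\<Sum>d=1..N. mangoldt d * real (n div d))"
proof -
  have "ln (fact n :: real) = (\<Sum>k=1..n. ln (real k))"
    by (simp add: fact_prod of_nat_prod, subst ln_prod) auto
  also have "\<dots> = (\<Sum>k=1..n. \<Sum>d | d dvd k. mangoldt d)"
    by (intro sum.cong refl) (auto simp: mangoldt_sum)
  also have "\<dots> = (\<Sum>k=1..n. \<Sum>d | d \<in> {1..N} \<and> d dvd k. mangoldt d)"
    using assms by (intro sum.cong refl) (auto dest: dvd_imp_le intro: Nat.gr0I)
  also have "\<dots> = (\<Sum>d=1..N. \<Sum>k | k \<in> {1..n} \<and> d dvd k. mangoldt d)"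
    by (rule sum.swap_restrict) auto
  also have "\<dots> = (\<Sum>d=1..N. mangoldt d * real (n div d))"
  proof (intro sum.cong refl)
    fix d assume d: "d \<in> {1..N}"
    have "{k. k \<in> {1..n} \<and> d dvd k} = (\<lambda>j. d * j) ` {1..n div d}"
    proof (intro equalityI subsetI)
      fix k assume "k \<in> {k. k \<in> {1..n} \<and> d dvd k}"
      then obtain j where "k = d * j" "1 \<le> d * j" "d * j \<le> n" by (auto elim!: dvdE)
      moreover from this have "j \<in> {1..n div d}"
        using d by (auto simp: less_eq_div_iff_mult_less_eq mult.commute intro: Nat.gr0I)
      ultimately show "k \<in> (\<lambda>j. d * j) ` {1..n div d}" by blast
    next
      fix k assume "k \<in> (\<lambda>j. d * j) ` {1..n div d}"
      then show "k \<in> {k. k \<in> {1..n} \<and> d dvd k}"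
        using d by (auto simp: less_eq_div_iff_mult_less_eq mult.commute)
    qed
    then have "card {k. k \<in> {1..n} \<and> d dvd k} = n div d"
      using d by (simp add: card_image inj_on_def)
    then show "(\<Sum>k | k \<in> {1..n} \<and> d dvd k. mangoldt d :: real) = mangoldt d * real (n div d)"
      by simp
  qed
  finally show ?thesis .
qed

text \<open>Chebyshev's combination: since \<open>1 - 1/2 - 1/3 - 1/5 + 1/30 = 0\<close>, the \<open>n ln n\<close> terms of the
  corresponding log-factorials cancel.\<close>

lemma chebyshev_coefficient_le_1:
  fixes m :: nat
  shows "m + m div 30 \<le> 1 + m div 2 + m div 3 + m div 5"
proof -
  \<comment> \<open>Raising m by 30 adds 31 = 15 + 10 + 6 to both sides, so one period
    suffices.\<close>
  define j t where "j = m div 30" and "t = m mod 30"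
  have m: "m = 30 * j + t" and "t < 30" by (simp_all add: j_def t_def)
  have "(30 * j + t) div 2 = 15 * j + t div 2" "(30 * j + t) div 3 = 10 * j + t div 3"
    "(30 * j + t) div 5 = 6 * j + t div 5" "(30 * j + t) div 30 = j + t div 30"
    by presburger+
  moreover have "\<forall>t\<in>set [0..<30]. t + t div 30 \<le> 1 + t div 2 + t div 3 + t div (5::nat)"
    by code_simp
  then have "t + t div 30 \<le> 1 + t div 2 + t div 3 + t div 5"
    using \<open>t < 30\<close> by simp
  ultimately show ?thesis unfolding m by linarith
qed

text \<open>By Legendre's formula the coefficient of \<open>mangoldt d\<close> in the combination
  depends only on \<open>n div d\<close>, since nested quotients commute. It is at most 1, and
  \<open>mangoldt\<close> is nonnegative.\<close>

lemma chebyshev_psi_ge: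
  "chebyshev_psi n \<ge> ln (fact n) - ln (fact (n div 2)) - ln (fact (n div 3))
     - ln (fact (n div 5)) + ln (fact (n div 30))"
proof -
  have "ln (fact n) - ln (fact (n div 2)) - ln (fact (n div 3)) - ln (fact (n div 5))
      + ln (fact (n div 30)) = (\<Sum>d=1..n. mangoldt d * (real (n div d) - real (n div 2 div d)
        - real (n div 3 div d) - real (n div 5 div d) + real (n div 30 div d)))"
    by (subst (1 2 3 4 5) ln_fact_conv_mangoldt[where N = n])
       (auto simp: ring_distribs sum.distrib sum_subtractf)
  also have "\<dots> \<le> (\<Sum>d=1..n. mangoldt d * 1)"
  proof (intro sum_mono mult_left_mono mangoldt_nonneg)
    fix d
    have "n div 2 div d = n div d div 2" "n div 3 div d = n div d div 3"
      "n div 5 div d = n div d div 5" "n div 30 div d = n div d div 30"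
      by (simp_all add: div_mult2_eq[symmetric] mult.commute)
    then show "real (n div d) - real (n div 2 div d) - real (n div 3 div d)
        - real (n div 5 div d) + real (n div 30 div d) \<le> 1"
      using chebyshev_coefficient_le_1[of "n div d"] by linarith
  qed
  finally show ?thesis by (simp add: chebyshev_psi_def)
qed

text \<open>Group the prime powers by their base: at most log_p n powers of p lie up to n, each
  contributing ln p, so p contributes at most ln n.\<close>

lemma chebyshev_psi_le: "chebyshev_psi n \<le> real (primes_upto n) * ln (real n)"
proof -
  define Q where "Q = {d. primepow d \<and> d \<in> {1..n}}"
  define S where "S = {p. prime p \<and> p \<le> n}"
  have [simp]: "finite Q" "finite S" by (auto simp: Q_def S_def)
  have "chebyshev_psi n = (\<Sum>d\<in>Q. ln (real (aprimedivisor d)))"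
    unfolding chebyshev_psi_def Q_def
    by (rule sum.mono_neutral_cong_right) (auto simp: mangoldt_def)
  also have "\<dots> = (\<Sum>p\<in>S. \<Sum>d | d \<in> Q \<and> aprimedivisor d = p. ln (real (aprimedivisor d)))"
  proof (rule sum.group[symmetric])
    show "aprimedivisor ` Q \<subseteq> S"
    proof
      fix p assume "p \<in> aprimedivisor ` Q"
      then obtain d where d: "primepow d" "1 \<le> d" "d \<le> n" "p = aprimedivisor d"
        by (auto simp: Q_def)
      then have "d > 1" using primepow_gt_Suc_0 by force
      then have "prime p" using d \<open>d > 1\<close> prime_aprimedivisor'[of d] by simp
      moreover have "p \<le> d" using d \<open>d > 1\<close> aprimedivisor_le_nat by force
      ultimately show "p \<in> S" using d by (simp add: S_def)
    qed
  qed auto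
  also have "\<dots> \<le> (\<Sum>p\<in>S. ln (real n))"
  proof (rule sum_mono)
    fix p assume "p \<in> S"
    then have p: "prime p" "p \<le> n" by (auto simp: S_def)
    then have p1: "p > 1" using prime_gt_1_nat by blast
    define k where "k = nat \<lfloor>log p n\<rfloor>"
    have sub: "{d \<in> Q. aprimedivisor d = p} \<subseteq> (\<lambda>j. p ^ j) ` {1..k}"
    proof
      fix d assume "d \<in> {d \<in> Q. aprimedivisor d = p}"
      then have d: "primepow d" "d \<le> n" "aprimedivisor d = p" by (auto simp: Q_def)
      then obtain q j where qj: "prime q" "j > 0" "d = q ^ j"
        by (auto simp: primepow_def)
      then have "q = p" using d by (simp add: aprimedivisor_prime_power)
      with qj d have "real p ^ j \<le> real n" by (metis of_nat_le_iff of_nat_power)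
      then have "real j \<le> log p n"
        using p1 p by (subst le_log_iff) (auto simp: powr_realpow)
      then have "j \<le> k" unfolding k_def by linarith
      then show "d \<in> (\<lambda>j. p ^ j) ` {1..k}" using qj \<open>q = p\<close> by auto
    qed
    have "card {d \<in> Q. aprimedivisor d = p} \<le> k"
      using card_mono[OF _ sub] card_image_le[of "{1..k}" "\<lambda>j. p ^ j"] by simp
    moreover have "real k \<le> log p n"
      using p1 p unfolding k_def by (simp add: zero_le_log_cancel_iff)
    ultimately have "real (card {d \<in> Q. aprimedivisor d = p}) * ln p \<le> log p n * ln p"
      using p1 by (intro mult_right_mono) auto
    also have "\<dots> = ln n" using p1 p by (simp add: log_def)
    finally show "(\<Sum>d | d \<in> Q \<and> aprimedivisor d = p. ln (real (aprimedivisor d))) \<le> ln (real n)"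
      by simp
  qed
  finally show ?thesis by (simp add: S_def primes_upto_def)
qed

section \<open>Stirling-type bounds for factorials and their floored arguments\<close>

text \<open>The induction step amounts to n (ln (n + 1) - ln n) \<le> 1.\<close>

lemma ln_fact_ge_nat:
  assumes "n \<ge> 1"
  shows "real n * ln n - n + 1 \<le> ln (fact n)"
  using assms
proof (induction n rule: dec_induct)
  case (step n)
  have "n * ln (1 + 1 / n) \<le> n * (1 / n)"
    using step.hyps by (intro mult_left_mono ln_add_one_self_le_self) auto
  moreover have "ln (1 + 1 / n) = ln (Suc n) - ln n"
    using step.hyps ln_div[of "real (Suc n)" "real n"] by (simp add: field_simps)
  ultimately have "n * ln (Suc n) - n * ln n \<le> 1" using step.hyps by (simp add: algebra_simps)
  moreover have "ln (fact (Suc n) :: real) = ln (Suc n) + ln (fact n)"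
    by (simp add: ln_mult del: of_nat_Suc)
  ultimately show ?case using step.IH by (simp add: algebra_simps)
qed auto

text \<open>The induction step amounts to (n + 1) (ln (n + 1) - ln n) \<ge> 1.\<close>

lemma ln_fact_le_nat:
  assumes "n \<ge> 1"
  shows "ln (fact n) \<le> real n * ln n - n + 1 + ln n"
  using assms
proof (induction n rule: dec_induct)
  case (step n)
  have "ln (1 - 1 / Suc n) \<le> - (1 / Suc n)"
    using step.hyps ln_le_minus_one[of "1 - 1 / Suc n"] by (simp add: field_simps)
  moreover have "ln (1 - 1 / Suc n) = ln n - ln (Suc n)"
    using step.hyps ln_div[of "real n" "real (Suc n)"] by (simp add: field_simps)
  ultimately have "1 / Suc n \<le> ln (Suc n) - ln n" by linarith
  then have "Suc n * (1 / Suc n) \<le> Suc n * (ln (Suc n) - ln n)"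
    by (intro mult_left_mono) auto
  then have "1 \<le> Suc n * ln (Suc n) - Suc n * ln n" by (simp add: algebra_simps)
  moreover have "ln (fact (Suc n) :: real) = ln (Suc n) + ln (fact n)"
    by (simp add: ln_mult del: of_nat_Suc)
  ultimately show ?case using step.IH by (simp add: algebra_simps)
qed auto

text \<open>A mean value estimate: x ln x - x has the increasing derivative ln x. It serves to
  replace a floor by the exact quotient in the factorial bounds.\<close>

lemma x_ln_x_diff_le:
  fixes x y :: real
  assumes "0 < x" "x \<le> y"
  shows "(y * ln y - y) - (x * ln x - x) \<le> (y - x) * ln y"
    and "(y - x) * ln x \<le> (y * ln y - y) - (x * ln x - x)"
proof -
  have *: "ln y - ln x \<le> (y - x) / x" "ln x - ln y \<le> (x - y) / y"
    using assms ln_diff_le by auto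
  then have "x * (ln y - ln x) \<le> y - x" "y * (ln x - ln y) \<le> x - y"
    using assms by (simp_all add: field_simps)
  then show "(y * ln y - y) - (x * ln x - x) \<le> (y - x) * ln y"
    and "(y - x) * ln x \<le> (y * ln y - y) - (x * ln x - x)"
    by (simp_all add: algebra_simps)
qed

text \<open>Passing from k = floor x to x raises the main term by at most (x - k) ln x \<le> ln x,
  which is subtracted.\<close>

lemma ln_fact_div_ge:
  assumes "m > 0" "n \<ge> m"
  defines "x \<equiv> real n / real m"
  shows "x * ln x - x + 1 - ln x \<le> ln (fact (n div m))"
proof -
  define k where "k = n div m"
  have k: "k \<ge> 1" using assms by (simp add: k_def div_greater_zero_iff Suc_le_eq)
  have "k = nat \<lfloor>x\<rfloor>"
    unfolding k_def x_def by (simp add: floor_divide_of_nat_eq)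
  moreover have "x \<ge> 0" by (simp add: x_def)
  ultimately have x: "real k \<le> x" "x < real k + 1" by linarith+
  have "(x - k) * ln x \<le> 1 * ln x"
    using x k by (intro mult_right_mono) auto
  then show ?thesis
    using x_ln_x_diff_le(1)[of k x] x k ln_fact_ge_nat[OF k] unfolding k_def[symmetric] by simp
qed

text \<open>No further loss occurs here, because y ln y - y and ln y do not decrease from k \<ge> 1
  to x.\<close>

lemma ln_fact_div_le:
  assumes "m > 0" "n \<ge> m"
  defines "x \<equiv> real n / real m"
  shows "ln (fact (n div m)) \<le> x * ln x - x + 1 + ln x"
proof -
  define k where "k = n div m"
  have k: "k \<ge> 1" using assms by (simp add: k_def div_greater_zero_iff Suc_le_eq)
  have "k = nat \<lfloor>x\<rfloor>"
    unfolding k_def x_def by (simp add: floor_divide_of_nat_eq)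
  moreover have "x \<ge> 0" by (simp add: x_def)
  ultimately have x: "real k \<le> x" by linarith
  have "0 \<le> (x - k) * ln k" using x k by simp
  moreover have "ln k \<le> ln x" using x k by simp
  ultimately show ?thesis
    using x_ln_x_diff_le(2)[of k x] x k ln_fact_le_nat[OF k] unfolding k_def[symmetric] by linarith
qed

text \<open>The terms n ln n and n cancel. What remains is n times Chebyshev's constant ln 2/2 + ln
  3/3 + ln 5/5 - ln 30/30, and each of the four floored quotients costs one ln n.\<close>

lemma chebyshev_psi_lower:
  assumes "n \<ge> 30"
  shows "(14 * ln 2 + 9 * ln 3 + 5 * ln 5) / 30 * real n - 4 * ln n + 5 \<le> chebyshev_psi n"
proof -
  define L where "L = ln (real n)"
  have ln30: "ln (30::real) = ln 2 + ln 3 + ln 5"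
    using ln_mult[of "2::real" 3] ln_mult[of "6::real" 5] by simp
  have ln: "ln (real n / m) = L - ln m" if "m > 0" for m :: real
    using assms that by (simp add: L_def ln_div)
  \<comment> \<open>The additive constants sum to 2 ln 30 - 1; the bound 2 ln 30 \<ge> 6 makes this
    at least 5.\<close>
  have "exp (6::real) = exp 1 ^ 6" by (simp add: exp_of_nat_mult[symmetric])
  also have "\<dots> \<le> 3 ^ 6" using exp_le by (intro power_mono) auto
  also have "\<dots> \<le> (900::real)" by simp
  finally have "6 \<le> ln (900::real)" by (subst ln_ge_iff) auto
  also have "ln (900::real) = 2 * ln 30" using ln_realpow[of "30::real" 2] by simp
  finally have c: "6 \<le> 2 * (ln 2 + ln 3 + ln (5::real))" by (simp add: ln30)
  have *: "real n * L - n + 1 \<le> ln (fact n)"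
    using ln_fact_ge_nat[of n] assms by (simp add: L_def)
  have "n / 30 * (L - ln 30) - n / 30 + 1 - (L - ln 30) \<le> ln (fact (n div 30))"
    using ln_fact_div_ge[of 30 n] assms by (simp add: ln)
  moreover have "ln (fact (n div 2)) \<le> n / 2 * (L - ln 2) - n / 2 + 1 + (L - ln 2)"
    using ln_fact_div_le[of 2 n] assms by (simp add: ln)
  moreover have "ln (fact (n div 3)) \<le> n / 3 * (L - ln 3) - n / 3 + 1 + (L - ln 3)"
    using ln_fact_div_le[of 3 n] assms by (simp add: ln)
  moreover have "ln (fact (n div 5)) \<le> n / 5 * (L - ln 5) - n / 5 + 1 + (L - ln 5)"
    using ln_fact_div_le[of 5 n] assms by (simp add: ln)
  ultimately show ?thesis
    using chebyshev_psi_ge[of n] * c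
    unfolding L_def[symmetric] ln30 by (simp add: field_simps)
qed

lemma primes_upto_lower:
  assumes "n \<ge> 30"
  shows "35 / 27 * ln 2 * real n + 5 \<le> (real (primes_upto n) + 4) * ln n"
proof -
  \<comment> \<open>Rational bounds for ln 3 / ln 2 and ln 5 / ln 2, just good enough: 81 * 3/2 + 45
    * 23/10 = 225.\<close>
  have "ln (2 ^ 3 :: real) \<le> ln (3 ^ 2)" "ln (2 ^ 23 :: real) \<le> ln (5 ^ 10)"
    by (subst ln_le_cancel_iff; simp)+
  then have "3 * ln 2 \<le> 2 * ln (3::real)" "23 * ln 2 \<le> 10 * ln (5::real)"
    by (simp_all only: ln_realpow zero_less_numeral of_nat_numeral)
  moreover have "ln (2::real) > 0" by simp
  ultimately have "224 * ln 2 \<le> 81 * ln 3 + 45 * ln (5::real)"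
    by linarith
  then have "35 / 27 * ln 2 \<le> (14 * ln 2 + 9 * ln 3 + 5 * ln (5::real)) / 30"
    by (simp add: field_simps)
  then have "35 / 27 * ln 2 * n \<le> (14 * ln 2 + 9 * ln 3 + 5 * ln (5::real)) / 30 * n"
    by (intro mult_right_mono) auto
  then show ?thesis
    using chebyshev_psi_lower[OF assms] chebyshev_psi_le[of n] unfolding distrib_right by linarith
qed

subsection \<open>The primes up to 1900\<close>

text \<open>The bound 1900 = 38 * 50 is the first multiple of 50 beyond p_285 = 1867.\<close>

definition small_primes :: "int list" where
  "small_primes =
  [2, 3, 5, 7, 11, 13, 17, 19, 23, 29, 31, 37, 41, 43, 47, 53, 59, 61, 67, 71, 73, 79, 83,
   89, 97, 101, 103, 107, 109, 113, 127, 131, 137, 139, 149, 151, 157, 163, 167, 173, 179,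
   181, 191, 193, 197, 199, 211, 223, 227, 229, 233, 239, 241, 251, 257, 263, 269, 271, 277,
   281, 283, 293, 307, 311, 313, 317, 331, 337, 347, 349, 353, 359, 367, 373, 379, 383, 389,
   397, 401, 409, 419, 421, 431, 433, 439, 443, 449, 457, 461, 463, 467, 479, 487, 491, 499,
   503, 509, 521, 523, 541, 547, 557, 563, 569, 571, 577, 587, 593, 599, 601, 607, 613, 617,
   619, 631, 641, 643, 647, 653, 659, 661, 673, 677, 683, 691, 701, 709, 719, 727, 733, 739,
   743, 751, 757, 761, 769, 773, 787, 797, 809, 811, 821, 823, 827, 829, 839, 853, 857, 859,
   863, 877, 881, 883, 887, 907, 911, 919, 929, 937, 941, 947, 953, 967, 971, 977, 983, 991,
   997, 1009, 1013, 1019, 1021, 1031, 1033, 1039, 1049, 1051, 1061, 1063, 1069, 1087, 1091,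
   1093, 1097, 1103, 1109, 1117, 1123, 1129, 1151, 1153, 1163, 1171, 1181, 1187, 1193, 1201,
   1213, 1217, 1223, 1229, 1231, 1237, 1249, 1259, 1277, 1279, 1283, 1289, 1291, 1297, 1301,
   1303, 1307, 1319, 1321, 1327, 1361, 1367, 1373, 1381, 1399, 1409, 1423, 1427, 1429, 1433,
   1439, 1447, 1451, 1453, 1459, 1471, 1481, 1483, 1487, 1489, 1493, 1499, 1511, 1523, 1531,
   1543, 1549, 1553, 1559, 1567, 1571, 1579, 1583, 1597, 1601, 1607, 1609, 1613, 1619, 1621,
   1627, 1637, 1657, 1663, 1667, 1669, 1693, 1697, 1699, 1709, 1721, 1723, 1733, 1741, 1747,
   1753, 1759, 1777, 1783, 1787, 1789, 1801, 1811, 1823, 1831, 1847, 1861, 1867,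
   1871, 1873, 1877, 1879, 1889]"

text \<open>Primes below 44 suffice because 44^2 = 1936 exceeds 1900.\<close>

definition trial_divisors :: "int list" where
  "trial_divisors = [2,3,5,7,11,13,17,19,23,29,31,37,41,43]"

text \<open>The range is cut into blocks of 50 because \<open>code_simp\<close> needs time quadratic in the length
  of an interval list.\<close>

lemma small_primes_eq:
  "small_primes = concat (map (\<lambda>k. filter (\<lambda>n. n > 1 \<and>
     (\<forall>d\<in>set trial_divisors. n mod d \<noteq> 0 \<or> n = d))
     [50 * k + 1..50 * k + 50]) [0..37])"
  by code_simp

lemma sorted_small_primes: "sorted_wrt (<) small_primes"
proof -
  have "successively (<) small_primes" by code_simp
  then show ?thesis by (simp add: successively_conv_sorted_wrt transp_on_def)
qed

text \<open>The square root criterion yields a divisor below 44 that may be composite; this check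
  leads from it to a trial divisor.\<close>

lemma small_divisor_check:
  "\<forall>p\<in>set [2..43::int]. \<exists>d\<in>set trial_divisors. p mod d = 0"
  by code_simp

lemma mem_concat_filter_upto:
  "n \<in> set (concat (map (\<lambda>k. filter Q [f k..g k]) [a..b])) \<longleftrightarrow>
     Q n \<and> (\<exists>k\<in>{a..b}. n \<in> {f k..g k})"
  by auto

lemma small_primes_iff: "int n \<in> set small_primes \<longleftrightarrow> prime n \<and> n \<le> 1900"
proof -
  define D where "D = set trial_divisors"
  have D_gt_1: "d > 1" if "d \<in> D" for d using that by (auto simp: D_def trial_divisors_def)
  have "(\<exists>k\<in>{0..37}. int n \<in> {50 * k + 1..50 * k + 50}) \<longleftrightarrow> 1 \<le> n \<and> n \<le> 1900"
  proof
    assume R: "1 \<le> n \<and> n \<le> 1900"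
    define k where "k = (int n - 1) div 50"
    have "k \<in> {0..37}" "int n \<in> {50 * k + 1..50 * k + 50}"
      using R unfolding k_def by auto
    then show "\<exists>k\<in>{0..37}. int n \<in> {50 * k + 1..50 * k + 50}" by blast
  qed auto
  then have mem: "int n \<in> set small_primes \<longleftrightarrow>
      1 < n \<and> n \<le> 1900 \<and> (\<forall>d\<in>D. int n mod d \<noteq> 0 \<or> int n = d)"
    unfolding small_primes_eq mem_concat_filter_upto D_def by linarith
  show ?thesis
  proof
    assume "int n \<in> set small_primes"
    then have R: "1 < n \<and> n \<le> 1900 \<and> (\<forall>d\<in>D. int n mod d \<noteq> 0 \<or> int n = d)"
      by (rule iffD1[OF mem])
    then have n: "1 < n" "n \<le> 1900" by simp_all
    have "prime n"
    proof (rule ccontr)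
      assume "\<not> prime n"
      then obtain p where p: "p dvd n" "p ^ 2 \<le> n" "p \<noteq> 1"
        using n prime_divisor_sqrt[of n] by auto
      have "p < 44"
      proof (rule ccontr)
        assume "\<not> p < 44"
        then have "44 ^ 2 \<le> p ^ 2" by (intro power_mono) auto
        with p n show False by simp
      qed
      moreover have "p \<ge> 2" using p n by (cases p) auto
      ultimately have "int p \<in> set [2..43]" unfolding set_upto by simp
      then have "\<exists>d\<in>D. int p mod d = 0"
        unfolding D_def by (rule small_divisor_check[THEN bspec])
      then obtain d where d: "d \<in> D" "int p mod d = 0" by (rule bexE)
      from d(2) have "d dvd int p" by (rule mod_0_imp_dvd)
      moreover have "int p dvd int n" using p(1) by simp
      ultimately have "d dvd int n" by (rule dvd_trans)
      \<comment> \<open>A trial divisor of n can only be n itself, contradicting d \<le> p < p^2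
        \<le> n.\<close>
      then have "int n = d" using R d(1) dvd_imp_mod_0 by metis
      moreover have "d \<le> int p"
        using \<open>d dvd int p\<close> \<open>p \<ge> 2\<close> by (intro zdvd_imp_le) auto
      moreover have "p < p ^ 2" using \<open>p \<ge> 2\<close> by (simp add: power2_eq_square)
      ultimately show False using p(2) by linarith
    qed
    with n show "prime n \<and> n \<le> 1900" by simp
  next
    assume n: "prime n \<and> n \<le> 1900"
    have "int n mod d \<noteq> 0 \<or> int n = d" if "d \<in> D" for d
    proof -
      have "d = int (nat d)" "nat d \<noteq> 1" using D_gt_1[OF that] by auto
      moreover have "nat d = n" if "nat d dvd n"
        using n that prime_nat_iff \<open>nat d \<noteq> 1\<close> by blast
      ultimately show ?thesis by (metis dvd_eq_mod_eq_0 of_nat_dvd_iff)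
    qed
    then have "1 < n \<and> n \<le> 1900 \<and> (\<forall>d\<in>D. int n mod d \<noteq> 0 \<or> int n = d)"
      using n prime_gt_1_nat by simp
    then show "int n \<in> set small_primes" by (rule iffD2[OF mem])
  qed
qed

text \<open>The early exit saves evaluation steps and is sound on increasing lists.\<close>

fun count_from :: "int \<Rightarrow> int list \<Rightarrow> int \<Rightarrow> int" where
  "count_from c [] n = c"
| "count_from c (p # ps) n = (if p \<le> n then count_from (c + 1) ps n else c)"

definition count_small :: "int \<Rightarrow> int" where
  "count_small = count_from 0 small_primes"

lemma count_from_eq:
  "sorted_wrt (<) ps \<Longrightarrow> count_from c ps n = c + int (card {p \<in> set ps. p \<le> n})"
proof (induction ps arbitrary: c)
  case (Cons p ps)
  show ?case
  proof (cases "p \<le> n")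
    case True
    have "p \<notin> set ps" using Cons.prems by auto
    moreover have "{q \<in> set (p # ps). q \<le> n} = insert p {q \<in> set ps. q \<le> n}"
      using True by auto
    ultimately have "card {q \<in> set (p # ps). q \<le> n} = Suc (card {q \<in> set ps. q \<le> n})"
      by simp
    then show ?thesis using Cons True by simp
  next
    case False
    then have "{q \<in> set (p # ps). q \<le> n} = {}" using Cons.prems by auto
    then have "card {q \<in> set (p # ps). q \<le> n} = 0" by (simp only: card.empty)
    then show ?thesis using False by simp
  qed
qed auto

lemma count_small_eq:
  assumes "n \<le> 1900"
  shows "count_small (int n) = int (primes_upto n)"
proof -
  have "{p \<in> set small_primes. p \<le> int n} = int ` {p. prime p \<and> p \<le> n}"
  proof (intro equalityI subsetI)
    fix p assume p: "p \<in> {p \<in> set small_primes. p \<le> int n}"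
    then have "p \<ge> 0" unfolding small_primes_eq mem_Collect_eq mem_concat_filter_upto by simp
    then obtain m where "p = int m" using nonneg_int_cases by blast
    with p show "p \<in> int ` {p. prime p \<and> p \<le> n}" by (auto simp: small_primes_iff)
  qed (use assms in \<open>auto simp: small_primes_iff\<close>)
  then show ?thesis
    by (simp add: count_small_def count_from_eq sorted_small_primes primes_upto_def card_image)
qed

text \<open>These values translate between r and P = p_{r+1}: r < 20 forces P \<le> 71, r \<ge> 20
  forces P > 72, and P \<ge> 1867 forces r \<ge> 284.\<close>

lemma count_small_values: "count_small 71 = 20" "count_small 72 = 20" "count_small 1867 = 285"
  by code_simp+

subsection \<open>An upper bound from sieving modulo 210\<close>

text \<open>48 = 1 * 2 * 4 * 6 is Euler's totient of 210 = 2 * 3 * 5 * 7.\<close>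

lemma length_residues_210:
  "length (filter (\<lambda>k. k mod 2 \<noteq> 0 \<and> k mod 3 \<noteq> 0 \<and> k mod 5 \<noteq> 0 \<and> k mod 7 \<noteq> 0) [0..209::int]) = 48"
  by code_simp

text \<open>A prime above n \<ge> 7 is coprime to 210, and a window of 210 consecutive integers
  meets each of the 48 coprime residue classes once.\<close>

lemma primes_upto_add_210:
  assumes "n \<ge> 7"
  shows "primes_upto (n + 210) \<le> primes_upto n + 48"
proof -
  define M where "M = {m \<in> {n<..n + 210}. \<not> 2 dvd m \<and> \<not> 3 dvd m \<and> \<not> 5 dvd m \<and> \<not> 7 dvd m}"
  define R :: "int list" where
    "R = filter (\<lambda>k. k mod 2 \<noteq> 0 \<and> k mod 3 \<noteq> 0 \<and> k mod 5 \<noteq> 0 \<and> k mod 7 \<noteq> 0) [0..209]"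
  have "inj_on (\<lambda>m. int (m mod 210)) M"
  proof (rule linorder_inj_onI)
    fix a b assume ab: "a < b" "a \<in> M" "b \<in> M"
    show "int (a mod 210) \<noteq> int (b mod 210)"
    proof
      assume "int (a mod 210) = int (b mod 210)"
      then have "210 dvd b - a" using ab(1) by (metis mod_eq_dvd_iff_nat less_imp_le of_nat_eq_iff)
      then have "210 \<le> b - a" using ab(1) by (intro dvd_imp_le) auto
      then show False using ab by (auto simp: M_def)
    qed
  qed auto
  then have "card M = card ((\<lambda>m. int (m mod 210)) ` M)" by (simp add: card_image)
  also have "\<dots> \<le> card (set R)"
  proof (intro card_mono image_subsetI)
    fix m assume "m \<in> M"
    then have m: "\<not> 2 dvd m" "\<not> 3 dvd m" "\<not> 5 dvd m" "\<not> 7 dvd m"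
      by (simp_all add: M_def)
    have res: "int (m mod 210) mod int d \<noteq> 0" if "d dvd 210" "\<not> d dvd m" for d
    proof -
      have "m mod 210 mod d = m mod d" using that(1) by (rule mod_mod_cancel)
      then have "m mod 210 mod d \<noteq> 0" using that(2) by (metis dvd_eq_mod_eq_0)
      then show ?thesis by (simp only: of_nat_mod[symmetric] of_nat_eq_0_iff not_False_eq_True)
    qed
    have dvd: "2 dvd (210::nat)" "3 dvd (210::nat)" "5 dvd (210::nat)" "7 dvd (210::nat)"
      by simp_all
    have "int (m mod 210) mod 2 \<noteq> 0" "int (m mod 210) mod 3 \<noteq> 0"
      "int (m mod 210) mod 5 \<noteq> 0" "int (m mod 210) mod 7 \<noteq> 0"
      using dvd[THEN res] m by (simp_all only: of_nat_numeral not_False_eq_True)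
    then show "int (m mod 210) \<in> set R"
      unfolding R_def set_filter set_upto mem_Collect_eq by (intro conjI) (assumption | simp)+
  qed simp
  also have "\<dots> \<le> 48"
    using card_length[of R] length_residues_210 unfolding R_def by (simp only:)
  finally have card_M: "card M \<le> 48" .
  have "{p. prime p \<and> p \<le> n + 210} \<subseteq> {p. prime p \<and> p \<le> n} \<union> M"
  proof
    fix p assume "p \<in> {p. prime p \<and> p \<le> n + 210}"
    then have p: "prime p" "p \<le> n + 210" by auto
    have "\<not> d dvd p" if "p > n" "d \<noteq> 1" "d \<le> 7" for d
    proof
      assume "d dvd p"
      then have "d = p" using p(1) that(2) prime_nat_iff by blast
      then show False using that assms by simp
    qed
    then show "p \<in> {p. prime p \<and> p \<le> n} \<union> M"
      using p by (cases "p \<le> n") (auto simp: M_def)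
  qed
  then have "primes_upto (n + 210) \<le> card ({p. prime p \<and> p \<le> n} \<union> M)"
    unfolding primes_upto_def by (intro card_mono) (auto simp: M_def)
  also have "\<dots> \<le> primes_upto n + card M"
    unfolding primes_upto_def by (rule card_Un_le)
  finally show ?thesis using card_M by simp
qed

text \<open>One full period of arguments, 284 to 493, as base of an induction with step 210.\<close>

lemma count_small_check:
  "\<forall>k\<in>set [0..29]. \<forall>n\<in>set [284 + 7 * k..290 + 7 * k]. 35 * count_small n + 135 \<le> 8 * n"
  by code_simp

text \<open>The additive constant 135 is chosen so that the logarithmic error terms in
  \<open>primes_upto_lower\<close> cancel exactly; 284 is the first argument from which on it is valid.\<close>

lemma primes_upto_upper:
  "n \<ge> 284 \<Longrightarrow> 35 * primes_upto n + 135 \<le> 8 * n"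
proof (induction n rule: less_induct)
  case (less n)
  show ?case
  proof (cases "n \<le> 493")
    case True
    define k where "k = (int n - 284) div 7"
    have "k \<in> set [0..29]" "int n \<in> set [284 + 7 * k..290 + 7 * k]"
      using True less.prems unfolding k_def set_upto by auto
    then have "35 * count_small (int n) + 135 \<le> 8 * int n"
      using count_small_check by blast
    then show ?thesis using True by (simp add: count_small_eq)
  next
    case False
    \<comment> \<open>The slope 8/35 equals 48/210: a step of 210 adds at most 35 * 48 = 8 * 210 to
      the left side.\<close>
    then have "35 * primes_upto (n - 210) + 135 \<le> 8 * (n - 210)"
      using less by simp
    moreover have "primes_upto n \<le> primes_upto (n - 210) + 48"
      using primes_upto_add_210[of "n - 210"] False by simp
    ultimately show ?thesis using False by linarith
  qed
qed

subsection \<open>Comparing the powers\<close>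

lemma two_power_less_large:
  assumes "primes_upto P = Suc r" "r \<ge> 284" "P \<ge> 30"
  shows "2 ^ P < P ^ (r - primes_upto r)"
proof -
  define L where "L = ln (real P)"
  have "L \<ge> 0" using assms by (simp add: L_def)
  have up: "35 * primes_upto r + 135 \<le> 8 * r" using assms by (intro primes_upto_upper)
  have "real (35 * primes_upto r + 135) \<le> real (8 * r)" using up of_nat_mono by blast
  \<comment> \<open>35 r - (8 r - 135) = 27 (r + 5), and r + 5 = pi(P) + 4 is the factor in
    Chebyshev's bound. The summand 5 there makes the product strict.\<close>
  then have "27 / 35 * (real r + 5) \<le> real (r - primes_upto r)"
    using up by (simp add: of_nat_diff)
  then have "27 / 35 * (real r + 5) * L \<le> real (r - primes_upto r) * L"
    using \<open>L \<ge> 0\<close> by (rule mult_right_mono)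
  moreover have "35 / 27 * ln 2 * real P + 5 \<le> (real r + 5) * L"
    using primes_upto_lower[of P] assms by (simp add: L_def add.commute)
  ultimately have "ln 2 * real P < real (r - primes_upto r) * L" by (simp add: field_simps)
  then have "ln (2 ^ P) < ln (real P ^ (r - primes_upto r))"
    using assms by (simp add: ln_realpow L_def mult.commute)
  then have "(2::real) ^ P < real P ^ (r - primes_upto r)"
    using assms by (subst (asm) ln_less_cancel_iff) auto
  then show ?thesis by (metis of_nat_less_iff of_nat_numeral of_nat_power)
qed

text \<open>A triple \<open>(v, w, q)\<close> handles all primes \<open>P\<close> with \<open>v < P \<le> w\<close>: the number \<open>q\<close> bounds
  \<open>8 log\<^sub>2 P\<close> from below, and \<open>r - \<pi>(r)\<close> is at least \<open>\<pi>(v) - \<pi>(\<pi>(v))\<close>.\<close>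

definition prime_rows :: "(int \<times> int \<times> nat) list" where
  "prime_rows = [(72, 73, 49),
   (78, 81, 50),
   (82, 89, 51),
   (96, 97, 52),
   (100, 105, 53),
   (106, 119, 53),
   (126, 137, 55),
   (138, 153, 56),
   (156, 181, 58),
   (190, 217, 60),
   (222, 247, 62),
   (250, 291, 63),
   (292, 349, 65),
   (352, 427, 67),
   (430, 524, 70),
   (540, 665, 72),
   (672, 853, 75),
   (856, 1087, 77),
   (1090, 1389, 80),
   (1398, 1805, 83),
   (1810, 1866, 86)]"

text \<open>The intervals leave gaps such as 74 to 78, but these contain no primes.\<close>

lemma prime_rows_cover:
  "\<forall>p\<in>set small_primes. p \<le> 72 \<or> p \<ge> 1867 \<or> (\<exists>(v, w, q)\<in>set prime_rows. v < p \<and> p \<le> w)"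
  by code_simp

text \<open>With k = r - pi(r), these conditions give 2^(8 P) < 2^(q k) \<le> P^(8 k) for v < P
  \<le> w. Working with eighth powers keeps the logarithm estimate in integers.\<close>

lemma prime_rows_check:
  "\<forall>(v, w, q)\<in>set prime_rows. 0 \<le> v \<and> v \<le> 1867 \<and> 2 ^ q \<le> (v + 1) ^ 8 \<and>
     (let a = count_small v in 8 * w < (a - count_small a) * int q)"
  by code_simp

lemma two_power_less_medium:
  assumes "primes_upto P = Suc r" "prime P" "72 < P" "P < 1867"
  shows "2 ^ P < P ^ (r - primes_upto r)"
proof -
  have "int P \<in> set small_primes" using assms by (simp add: small_primes_iff)
  then have "\<exists>(v, w, q)\<in>set prime_rows. v < int P \<and> int P \<le> w"
    using bspec[OF prime_rows_cover, of "int P"] assms(3,4) by simp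
  then obtain v w q where row: "(v, w, q) \<in> set prime_rows" "v < int P" "int P \<le> w"
    by auto
  define a where "a = count_small v"
  have check: "0 \<le> v" "v \<le> 1867" "2 ^ q \<le> (v + 1) ^ 8" "8 * w < (a - count_small a) * int q"
    using bspec[OF prime_rows_check row(1)] unfolding a_def by (simp_all add: Let_def)
  obtain v' where v': "v = int v'" using check(1) nonneg_int_cases by blast
  define a' where "a' = primes_upto v'"
  have a: "a = int a'" using check(2) by (simp add: a_def a'_def v' count_small_eq)
  \<comment> \<open>The prime P > v is not counted in pi(v), so pi(v) \<le> r and monotonicity of n
    - pi(n) applies.\<close>
  have "a' < Suc r" using assms row(2) primes_upto_less[of v' P] by (simp add: a'_def v')
  then have "a' \<le> r" by simp
  have "a' \<le> v'" unfolding a'_def by (rule primes_upto_le)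
  then have ca: "count_small a = int (primes_upto a')"
    using check(2) by (simp add: a v' count_small_eq)
  define k where "k = r - primes_upto r"
  have "int a' - int (primes_upto a') \<le> int k"
    using primes_upto_diff_le[OF \<open>a' \<le> r\<close>] \<open>a' \<le> r\<close> unfolding k_def by linarith
  then have "(a - count_small a) * int q \<le> int k * int q"
    unfolding ca unfolding a by (intro mult_right_mono) auto
  then have "int (8 * P) < int (q * k)" using check(4) row(3) by (simp add: mult.commute)
  then have "8 * P < q * k" by (simp only: of_nat_less_iff)
  have "(v + 1) ^ 8 \<le> int P ^ 8" using row(2) check(1) by (intro power_mono) auto
  with check(3) have "int (2 ^ q) \<le> int (P ^ 8)" by simp
  then have q: "2 ^ q \<le> P ^ 8" by (simp only: of_nat_le_iff)
  have "(2 ^ P) ^ 8 = (2::nat) ^ (8 * P)" by (simp add: power_mult[symmetric] mult.commute)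
  also have "\<dots> < 2 ^ (q * k)" using \<open>8 * P < q * k\<close> by simp
  also have "\<dots> \<le> (P ^ 8) ^ k" unfolding power_mult using q by (intro power_mono) auto
  also have "\<dots> = (P ^ k) ^ 8" by (simp add: power_mult[symmetric] mult.commute)
  finally show ?thesis unfolding k_def by (rule power_less_imp_less_base) simp
qed

section \<open>The range r < 20\<close>

lemma set_takeWhile_le:
  fixes ps :: "'a :: linorder list"
  assumes "sorted_wrt (<) ps"
  shows "set (takeWhile (\<lambda>p. p \<le> n) ps) = {p \<in> set ps. p \<le> n}"
  using assms by (induction ps) auto

text \<open>The primes up to p_20 = 71 are the p_{r+1} with r < 20; their powers are small enough
  for direct comparison.\<close>

lemma initial_primes_check:
  "\<forall>p\<in>set (takeWhile (\<lambda>p. p \<le> 71) small_primes).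
     (let r = count_small p - 1 in p ^ nat (r - count_small r) < 2 ^ nat p)"
  by code_simp

lemma power_less_two_power:
  assumes "primes_upto P = Suc r" "prime P" "r < 20"
  shows "P ^ (r - primes_upto r) < 2 ^ P"
proof -
  have "P \<le> 71"
  proof (rule ccontr)
    assume "\<not> P \<le> 71"
    then have "primes_upto 71 < Suc r" using assms primes_upto_less[of 71 P] by simp
    then show False using assms(3) count_small_values(1) count_small_eq[of 71] by simp
  qed
  then have "int P \<in> set small_primes" using assms by (simp add: small_primes_iff)
  then have "int P \<in> set (takeWhile (\<lambda>p. p \<le> 71) small_primes)"
    using \<open>P \<le> 71\<close> by (simp add: set_takeWhile_le sorted_small_primes)
  moreover have "count_small (int P) - 1 = int r"
    using \<open>P \<le> 71\<close> assms(1) by (simp add: count_small_eq)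
  ultimately have "int P ^ nat (int r - count_small (int r)) < 2 ^ nat (int P)"
    using bspec[OF initial_primes_check, of "int P"] by (simp add: Let_def)
  then have "int (P ^ (r - primes_upto r)) < int (2 ^ P)"
    using assms(3) by (simp add: count_small_eq nat_diff_distrib')
  then show ?thesis by (simp only: of_nat_less_iff)
qed

theorem theorem1:
  shows "(\<forall>r::nat. r \<ge> 20 \<longrightarrow>
            real (nth_prime (r + 1)) powi (int r - int (prime_pi (real r))) > 2 ^ nth_prime (r + 1))
       \<and> (\<forall>r::nat. 1 \<le> r \<and> r < 20 \<longrightarrow>
            real (nth_prime (r + 1)) powi (int r - int (prime_pi (real r))) < 2 ^ nth_prime (r + 1))"
proof -
  \<comment> \<open>Since pi(r) \<le> r, the integer exponent is nonnegative and the truncated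
    difference agrees with it.\<close>
  have powi: "real P powi (int r - int (prime_pi (real r))) = real (P ^ (r - primes_upto r))" for P r
  proof -
    have "prime_pi (real r) = primes_upto r"
      by (simp add: prime_pi_def primes_upto_def)
    moreover have "int r - int (primes_upto r) = int (r - primes_upto r)"
      using primes_upto_le[of r] by simp
    ultimately show ?thesis by (simp only: power_int_of_nat of_nat_power)
  qed
  have large: "2 ^ nth_prime (Suc r) < nth_prime (Suc r) ^ (r - primes_upto r)" if "r \<ge> 20" for r
  proof -
    define P where "P = nth_prime (Suc r)"
    have P: "prime P" "primes_upto P = Suc r"
      unfolding P_def by (rule prime_nth_prime primes_upto_nth_prime)+
    have "72 < P"
    proof (rule ccontr)
      assume "\<not> 72 < P"
      then have "Suc r \<le> primes_upto 72" using P primes_upto_mono[of P 72] by simp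
      then show False using that count_small_values(2) count_small_eq[of 72] by simp
    qed
    have "2 ^ P < P ^ (r - primes_upto r)"
    proof (cases "P < 1867")
      case True
      then show ?thesis using P \<open>72 < P\<close> by (intro two_power_less_medium)
    next
      case False
      then have "primes_upto 1867 \<le> Suc r" using P primes_upto_mono[of 1867 P] by simp
      then have "r \<ge> 284" using count_small_values(3) count_small_eq[of 1867] by simp
      then show ?thesis using P False by (intro two_power_less_large) auto
    qed
    then show ?thesis by (simp add: P_def)
  qed
  have small: "nth_prime (Suc r) ^ (r - primes_upto r) < 2 ^ nth_prime (Suc r)" if "r < 20" for r
    using that by (intro power_less_two_power primes_upto_nth_prime prime_nth_prime)
  have "real (2 ^ nth_prime (Suc r)) < real (nth_prime (Suc r) ^ (r - primes_upto r))"
    if "r \<ge> 20" for r using large[OF that] by (simp only: of_nat_less_iff)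
  moreover have "real (nth_prime (Suc r) ^ (r - primes_upto r)) < real (2 ^ nth_prime (Suc r))"
    if "r < 20" for r using small[OF that] by (simp only: of_nat_less_iff)
  ultimately show ?thesis unfolding powi by simp
qed

end
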